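(* Let $Y$ be a continuum. Then $Y$ is indecomposable if and only if there is a meager composant $X$ of $Y$ such that $X$ is singular dense in $Y$ and $X$ is a filament set in $Y$.
   Context: A continuum is a connected compact metrizable space with more than one point. A subcontinuum of a continuum $Y$ is a non-empty compact connected subset of $Y$ (one-point subsets are allowed). A continuum $Y$ is decomposable if $Y=H\cup K$ for some two proper subcontinua $H,K\subsetneq Y$; otherwise it is indecomposable. For a continuum $Y$ and $x\in Y$, the meager composant of $x$ in $Y$ is the union of all subcontinua of $Y$ that contain $x$ and are nowhere dense in $Y$; a meager composant of $Y$ is the meager composant of some point of $Y$. A subcontinuum $K$ of $Y$ is filament if there is a neighborhood $N$ of $K$ in $Y$ (a set whose interior contains $K$) such that the connected component of $N$ containing $K$ is nowhere dense in $Y$. A subset $X\subseteq Y$ is a filament set if every subcontinuum of $Y$ contained in $X$ is filament. A connected subset $X$ of $Y$ is singular with respect to a point $y\in Y$ if for every connected $C\subseteq X$ such that $y$ belongs to the closure of $C$ in $Y$, the closure of $C$ in $X$ equals $X$. $X$ is singular in $Y$ if it is singular with respect to some $y\in Y$, and singular dense in $Y$ if it is both singular in $Y$ and dense in $Y$. *)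

theory Defs
  imports "HOL-Analysis.Analysis"
begin

definition continuum_space :: "'a topology \<Rightarrow> bool" where
  "continuum_space Y \<longleftrightarrow>
     connected_space Y \<and> compact_space Y \<and> metrizable_space Y \<and>
     (\<exists>x\<in>topspace Y. \<exists>y\<in>topspace Y. x \<noteq> y)"

(* One-point subcontinua are allowed. *)
definition subcontinuum :: "'a topology \<Rightarrow> 'a set \<Rightarrow> bool" where
  "subcontinuum Y K \<longleftrightarrow> K \<noteq> {} \<and> compactin Y K \<and> connectedin Y K"

definition decomposable :: "'a topology \<Rightarrow> bool" where
  "decomposable Y \<longleftrightarrow>
     (\<exists>H K. subcontinuum Y H \<and> H \<noteq> topspace Y \<and>
            subcontinuum Y K \<and> K \<noteq> topspace Y \<and>
            topspace Y = H \<union> K)"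

abbreviation indecomposable :: "'a topology \<Rightarrow> bool" where
  "indecomposable Y \<equiv> \<not> decomposable Y"

definition nowhere_dense_in :: "'a topology \<Rightarrow> 'a set \<Rightarrow> bool" where
  "nowhere_dense_in Y S \<longleftrightarrow> S \<subseteq> topspace Y \<and> Y interior_of (Y closure_of S) = {}"

definition dense_in :: "'a topology \<Rightarrow> 'a set \<Rightarrow> bool" where
  "dense_in Y S \<longleftrightarrow> S \<subseteq> topspace Y \<and> Y closure_of S = topspace Y"

definition meager_composant_of :: "'a topology \<Rightarrow> 'a \<Rightarrow> 'a set" where
  "meager_composant_of Y x = \<Union>{K. subcontinuum Y K \<and> x \<in> K \<and> nowhere_dense_in Y K}"

definition meager_composant :: "'a topology \<Rightarrow> 'a set \<Rightarrow> bool" where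
  "meager_composant Y X \<longleftrightarrow> (\<exists>x\<in>topspace Y. X = meager_composant_of Y x)"

(* The neighbourhood N need not be open. Since K is non-empty and connected, the component C
   of N containing K exists and is unique. *)
definition filament_subcontinuum :: "'a topology \<Rightarrow> 'a set \<Rightarrow> bool" where
  "filament_subcontinuum Y K \<longleftrightarrow>
     subcontinuum Y K \<and>
     (\<exists>N\<subseteq>topspace Y. K \<subseteq> Y interior_of N \<and>
        (\<exists>C\<in>connected_components_of (subtopology Y N). K \<subseteq> C \<and> nowhere_dense_in Y C))"

definition filament_set :: "'a topology \<Rightarrow> 'a set \<Rightarrow> bool" where
  "filament_set Y X \<longleftrightarrow>
     X \<subseteq> topspace Y \<and>
     (\<forall>K. subcontinuum Y K \<and> K \<subseteq> X \<longrightarrow> filament_subcontinuum Y K)"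

definition singular_wrt :: "'a topology \<Rightarrow> 'a set \<Rightarrow> 'a \<Rightarrow> bool" where
  "singular_wrt Y X y \<longleftrightarrow>
     connectedin Y X \<and> y \<in> topspace Y \<and>
     (\<forall>C\<subseteq>X. connectedin Y C \<and> y \<in> Y closure_of C \<longrightarrow> subtopology Y X closure_of C = X)"

definition singular_in :: "'a topology \<Rightarrow> 'a set \<Rightarrow> bool" where
  "singular_in Y X \<longleftrightarrow> (\<exists>y\<in>topspace Y. singular_wrt Y X y)"

definition singular_dense_in :: "'a topology \<Rightarrow> 'a set \<Rightarrow> bool" where
  "singular_dense_in Y X \<longleftrightarrow> singular_in Y X \<and> dense_in Y X"

end

theory Submission
  imports Defs
begin

text \<open>If \<open>Y\<close> is indecomposable, its proper subcontinua are nowhere dense, so every meager composant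
  \<open>X\<close> is a dense ordinary composant; by Baire's theorem it omits a point, and any omitted point
  witnesses singularity.

  Conversely, a set \<open>X\<close> that is singular and dense is not the union of two proper, relatively closed
  connected subsets, so a connected subset of \<open>X\<close> that is not dense in \<open>Y\<close> is nowhere dense in \<open>Y\<close>.
  Given a proper subcontinuum \<open>H\<close> with interior that contains the base point \<open>x\<close>, let \<open>A\<close> be the
  union of all nowhere dense subcontinua \<open>K\<close> with \<open>x \<in> K \<subseteq> H\<close>. Its closure is nowhere dense,
  hence itself a member of the family and a filament subcontinuum. A slightly larger continuum in
  \<open>H\<close> is then still nowhere dense, contradicting maximality.\<close>

section \<open>Decompositions along a closed connected subset\<close>

text \<open>A part of a separation of \<open>K \<union> C1\<close> that misses \<open>K\<close> lies
  in \<open>C1\<close>, which is already separated from \<open>C2\<close>; it would be clopen in the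
  whole space.\<close>

lemma connectedin_Un_component_complement:
  assumes Z: "connected_space Z" and K: "closedin Z K" "connectedin Z K" "K \<noteq> {}"
    and C: "C1 \<union> C2 = topspace Z - K" "separatedin Z C1 C2"
  shows "closedin Z (K \<union> C1)" "connectedin Z (K \<union> C1)"
proof -
  have clo: "closedin Z (K \<union> D1)" if "D1 \<union> D2 = topspace Z - K" "separatedin Z D1 D2" for D1 D2
  proof -
    have "D1 \<subseteq> topspace Z" "Z closure_of D1 \<inter> D2 = {}"
      using that by (auto simp: separatedin_def)
    moreover have "Z closure_of D1 \<subseteq> topspace Z" by (rule closure_of_subset_topspace)
    moreover have "D1 \<subseteq> Z closure_of D1"
      by (simp add: \<open>D1 \<subseteq> topspace Z\<close> closure_of_subset)
    ultimately have "K \<union> D1 = K \<union> Z closure_of D1"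
      using that(1) by blast
    then show ?thesis
      using K(1) by (simp add: closedin_Un)
  qed
  show c1: "closedin Z (K \<union> C1)"
    using clo C by blast
  have c2: "closedin Z (K \<union> C2)"
    using clo[of C2 C1] C by (simp add: separatedin_sym Un_commute)
  have disj: "C1 \<inter> C2 = {}"
    using separatedin_imp_disjoint[OF C(2)] by (simp add: disjnt_def)
  have KZ: "K \<subseteq> topspace Z"
    using K(1) closedin_subset by blast
  \<comment> \<open>The complement of \<open>Q\<close> is the closed set
    \<open>P \<union> (K \<union> C2)\<close>, which contains the nonempty \<open>K\<close>.\<close>
  have no_split: "Q = {}"
    if PQ: "closedin Z P" "closedin Z Q" "P \<union> Q = K \<union> C1" "P \<inter> Q = {}" "K \<subseteq> P" for P Q
  proof -
    have "topspace Z - Q = P \<union> (K \<union> C2)"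
      using PQ C(1) disj KZ by blast
    then have "openin Z Q"
      using PQ(1,2) c2 by (metis closedin_Un closedin_subset openin_closedin)
    then have "Q = {} \<or> Q = topspace Z"
      using Z PQ(2) by (auto simp: connected_space_clopen_in)
    then show ?thesis
      using PQ K(3) KZ by blast
  qed
  show "connectedin Z (K \<union> C1)"
    unfolding connectedin_eq_not_separated
  proof (intro conjI notI)
    show "K \<union> C1 \<subseteq> topspace Z"
      using c1 closedin_subset by blast
    assume "\<exists>P Q. P \<union> Q = K \<union> C1 \<and> P \<noteq> {} \<and> Q \<noteq> {} \<and> separatedin Z P Q"
    then obtain P Q where PQ: "P \<union> Q = K \<union> C1" "P \<noteq> {}" "Q \<noteq> {}" and sep: "separatedin Z P Q"
      by blast
    have cl: "closedin Z P" "closedin Z Q"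
      using sep c1 PQ(1) closedin_trans_full by (metis separation_closedin_Un_gen)+
    have "P \<inter> Q = {}"
      using separatedin_imp_disjoint[OF sep] by (simp add: disjnt_def)
    moreover have "K \<subseteq> P \<or> K \<subseteq> Q"
      using K(2) sep PQ(1) unfolding connectedin_eq_not_separated_subset by blast
    ultimately show False
      using no_split[of P Q] no_split[of Q P] cl PQ by auto
  qed
qed

text \<open>If the complement of \<open>K\<close> is connected, its closure is proper because it
  misses the interior of \<open>K\<close>; otherwise both sides of a separation of the complement
  are glued to \<open>K\<close>. Stated for connected spaces so as to apply both to \<open>Y\<close>
  and to the subspace on a singular dense set.\<close>

lemma proper_closed_connected_decomposition:
  assumes Z: "connected_space Z" and K: "closedin Z K" "connectedin Z K" "K \<noteq> topspace Z"
    and int: "Z interior_of K \<noteq> {}"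
  obtains A B where "closedin Z A" "connectedin Z A" "A \<noteq> topspace Z"
    "closedin Z B" "connectedin Z B" "B \<noteq> topspace Z" "A \<union> B = topspace Z"
proof (cases "connectedin Z (topspace Z - K)")
  case True
  have "Z closure_of (topspace Z - K) = topspace Z - Z interior_of K"
    by (simp add: closure_of_complement)
  moreover have "Z interior_of K \<subseteq> K" "K \<subseteq> topspace Z"
    using K(1) by (auto simp: interior_of_subset closedin_subset)
  ultimately have "Z closure_of (topspace Z - K) \<noteq> topspace Z" "K \<union> Z closure_of (topspace Z - K) = topspace Z"
    using int by blast+
  then show ?thesis
    using that[OF K closedin_closure_of connectedin_closure_of[OF True]] by blast
next
  case False
  then obtain C1 C2 where C: "C1 \<union> C2 = topspace Z - K" "C1 \<noteq> {}" "C2 \<noteq> {}" "separatedin Z C1 C2"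
    unfolding connectedin_eq_not_separated by blast
  have ne: "K \<noteq> {}" and KZ: "K \<subseteq> topspace Z"
    using int K(1) closedin_subset by auto
  have disj: "C1 \<inter> C2 = {}"
    using separatedin_imp_disjoint[OF C(4)] by (simp add: disjnt_def)
  have C': "C2 \<union> C1 = topspace Z - K" "separatedin Z C2 C1"
    using C by (auto simp: separatedin_sym)
  show ?thesis
  proof (rule that)
    show "K \<union> C1 \<noteq> topspace Z" "K \<union> C2 \<noteq> topspace Z" "(K \<union> C1) \<union> (K \<union> C2) = topspace Z"
      using C disj KZ by blast+
  qed (intro connectedin_Un_component_complement[OF Z K(1,2) ne C(1,4)]
      connectedin_Un_component_complement[OF Z K(1,2) ne C'])+
qed

section \<open>Countable bases, subcontinua and nowhere dense sets\<close>

lemma compact_metrizable_imp_second_countable: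
  assumes "compact_space Y" "metrizable_space Y"
  shows "second_countable Y"
proof -
  obtain M d where "Metric_space M d" and Y: "Y = Metric_space.mtopology M d"
    using assms(2) unfolding metrizable_space_def by blast
  then interpret Metric_space M d by blast
  have "mtotally_bounded M"
    using assms(1) Y compact_space_eq_mcomplete_mtotally_bounded by blast
  then have "\<exists>F. finite F \<and> F \<subseteq> M \<and> M \<subseteq> (\<Union>x\<in>F. mball x (1 / real (Suc n)))" for n
    unfolding mtotally_bounded_def by (meson divide_pos_pos of_nat_0_less_iff zero_less_Suc zero_less_one)
  then obtain F where F: "\<And>n. finite (F n)" "\<And>n. F n \<subseteq> M"
      "\<And>n. M \<subseteq> (\<Union>x\<in>F n. mball x (1 / real (Suc n)))"
    by metis
  define B where "B = (\<Union>n. (\<lambda>x. mball x (1 / real (Suc n))) ` F n)"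
  have "countable B"
    unfolding B_def using F(1) by (simp add: uncountable_infinite countable_finite)
  moreover have "openin Y V" if "V \<in> B" for V
    using that by (auto simp: B_def Y)
  moreover have "\<exists>V\<in>B. x \<in> V \<and> V \<subseteq> U" if "openin Y U" "x \<in> U" for U x
  proof -
    have "x \<in> M"
      using that openin_subset[of Y U] by (auto simp: Y)
    obtain r where r: "r > 0" "mball x r \<subseteq> U"
      using conjunct2[OF \<open>openin Y U\<close>[unfolded Y openin_mtopology]] \<open>x \<in> U\<close> by blast
    \<comment> \<open>Half of \<open>r\<close>, because two points of a ball are less than twice its
      radius apart.\<close>
    obtain n where n: "1 / real (Suc n) < r / 2"
      using nat_approx_posE[of "r/2"] r(1) by (metis half_gt_zero)
    obtain a where a: "a \<in> F n" "x \<in> mball a (1 / real (Suc n))"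
      using F(3) \<open>x \<in> M\<close> by blast
    have "mball a (1 / real (Suc n)) \<subseteq> mball x r"
    proof
      fix z assume "z \<in> mball a (1 / real (Suc n))"
      then show "z \<in> mball x r"
        using a(2) n triangle[of x a z] commute[of a x] by (auto simp: in_mball)
    qed
    then show ?thesis
      using a r(2) by (auto simp: B_def)
  qed
  ultimately show ?thesis
    unfolding second_countable_def by blast
qed

lemma continuum_spaceD:
  assumes "continuum_space Y"
  shows "connected_space Y" "compact_space Y" "Hausdorff_space Y" "normal_space Y"
    "completely_metrizable_space Y" "topspace Y \<noteq> {}"
proof -
  show *: "connected_space Y" "compact_space Y" and "topspace Y \<noteq> {}"
    using assms by (auto simp: continuum_space_def)
  have met: "metrizable_space Y"
    using assms by (simp add: continuum_space_def)
  then show **: "Hausdorff_space Y"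
    by (rule metrizable_imp_Hausdorff_space)
  show "normal_space Y"
    using * ** by (simp add: compact_Hausdorff_or_regular_imp_normal_space)
  show "completely_metrizable_space Y"
    using * met
    by (simp add: locally_compact_imp_completely_metrizable_space compact_imp_locally_compact_space)
qed

lemma subcontinuum_iff_closedin:
  assumes "compact_space Y" "Hausdorff_space Y"
  shows "subcontinuum Y K \<longleftrightarrow> K \<noteq> {} \<and> closedin Y K \<and> connectedin Y K"
  unfolding subcontinuum_def
  using compactin_imp_closedin[OF assms(2)] closedin_compact_space[OF assms(1)] by blast

lemma nowhere_dense_in_closure_of:
  "nowhere_dense_in Y S \<Longrightarrow> nowhere_dense_in Y (Y closure_of S)"
  by (simp add: nowhere_dense_in_def closure_of_subset_topspace)

lemma nowhere_dense_in_subset: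
  "nowhere_dense_in Y T \<Longrightarrow> S \<subseteq> T \<Longrightarrow> nowhere_dense_in Y S"
  unfolding nowhere_dense_in_def
  by (metis closure_of_mono interior_of_mono subset_empty subset_trans)

lemma connectedin_meager_composant_of: "connectedin Y (meager_composant_of Y x)"
  unfolding meager_composant_of_def
proof (rule connectedin_Union)
  show "\<Inter> {K. subcontinuum Y K \<and> x \<in> K \<and> nowhere_dense_in Y K} \<noteq> {}"
    by blast
qed (auto simp: subcontinuum_def)

lemma subset_meager_composant_of:
  "subcontinuum Y K \<Longrightarrow> x \<in> K \<Longrightarrow> nowhere_dense_in Y K \<Longrightarrow> K \<subseteq> meager_composant_of Y x"
  by (auto simp: meager_composant_of_def)

section \<open>Meager composants of indecomposable continua\<close>

text \<open>An interior point of \<open>K\<close> would let \<open>Y\<close> be split into two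
  proper subcontinua; as \<open>K\<close> is closed, empty interior suffices.\<close>

lemma indecomposable_imp_nowhere_dense_in:
  assumes Y: "continuum_space Y" and ind: "indecomposable Y"
    and K: "subcontinuum Y K" "K \<noteq> topspace Y"
  shows "nowhere_dense_in Y K"
proof -
  note D = continuum_spaceD[OF Y]
  note sc = subcontinuum_iff_closedin[OF D(2,3)]
  have cK: "closedin Y K" "connectedin Y K"
    using K by (auto simp: sc)
  have "Y interior_of K = {}"
  proof (rule ccontr)
    assume "Y interior_of K \<noteq> {}"
    then obtain A B where "closedin Y A" "connectedin Y A" "A \<noteq> topspace Y"
      "closedin Y B" "connectedin Y B" "B \<noteq> topspace Y" "A \<union> B = topspace Y"
      using proper_closed_connected_decomposition[OF D(1) cK K(2)] by metis
    moreover from this have "A \<noteq> {}" "B \<noteq> {}" by auto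
    ultimately have "decomposable Y"
      unfolding decomposable_def sc by metis
    then show False using ind by simp
  qed
  then show ?thesis
    using cK closedin_subset by (auto simp: nowhere_dense_in_def closure_of_closedin)
qed

lemma component_of_closedin_subcontinuum:
  assumes "compact_space Y" "Hausdorff_space Y" "closedin Y S"
    and C: "C \<in> connected_components_of (subtopology Y S)"
  shows "subcontinuum Y C" "C \<subseteq> S"
proof -
  have "closedin Y C"
    using closedin_connected_components_of[OF C] assms(3) closedin_trans_full by blast
  moreover have "connectedin Y C" "C \<subseteq> S"
    using connectedin_connected_components_of[OF C] by (auto simp: connectedin_subtopology)
  ultimately show "subcontinuum Y C" "C \<subseteq> S"
    using nonempty_connected_components_of[OF C]
    by (auto simp: subcontinuum_iff_closedin[OF assms(1,2)])
qed

text \<open>Boundary bumping: if the closure missed a point, the component of \<open>x\<close> in a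
  proper closed neighbourhood of that closure would be a proper subcontinuum, hence part of the
  composant, yet would reach the frontier of the neighbourhood.\<close>

lemma indecomposable_meager_composant_of_dense:
  assumes Y: "continuum_space Y" and ind: "indecomposable Y" and x: "x \<in> topspace Y"
  shows "dense_in Y (meager_composant_of Y x)"
proof -
  note D = continuum_spaceD[OF Y]
  let ?X = "meager_composant_of Y x"
  have XY: "?X \<subseteq> topspace Y"
    by (rule connectedin_subset_topspace[OF connectedin_meager_composant_of])
  \<comment> \<open>A continuum has two points, so \<open>{x}\<close> is a proper
    subcontinuum.\<close>
  have xX: "x \<in> ?X"
  proof (rule subsetD[OF subset_meager_composant_of])
    have "{x} \<noteq> topspace Y"
      using Y unfolding continuum_space_def by (metis singletonD)
    moreover show "subcontinuum Y {x}"
      using x by (simp add: subcontinuum_def)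
    ultimately show "nowhere_dense_in Y {x}"
      using indecomposable_imp_nowhere_dense_in[OF Y ind] by blast
  qed auto
  have "Y closure_of ?X = topspace Y"
  proof (rule ccontr)
    assume ne: "Y closure_of ?X \<noteq> topspace Y"
    then obtain p where p: "p \<in> topspace Y" "p \<notin> Y closure_of ?X"
      using closure_of_subset_topspace by fastforce
    have "openin Y (topspace Y - {p})" "Y closure_of ?X \<subseteq> topspace Y - {p}"
      using p D(3) closure_of_subset_topspace[of Y ?X] by (auto simp: closedin_Hausdorff_sing_eq)
    then obtain V where V: "openin Y V" "Y closure_of ?X \<subseteq> V" "Y closure_of V \<subseteq> topspace Y - {p}"
      using D(4) unfolding normal_space_alt by (metis closedin_closure_of)
    let ?S = "Y closure_of V"
    let ?C = "connected_component_of_set (subtopology Y ?S) x"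
    have "V \<subseteq> ?S"
      by (simp add: V(1) closure_of_subset openin_subset)
    then have xS: "x \<in> topspace (subtopology Y ?S)"
      using xX V XY x closure_of_subset[of ?X Y] by auto
    then have C: "?C \<in> connected_components_of (subtopology Y ?S)"
      by (simp add: connected_component_in_connected_components_of)
    note CC = component_of_closedin_subcontinuum[OF D(2,3) closedin_closure_of C]
    have "?S \<noteq> topspace Y"
      using V(3) p(1) by blast
    then have "?C \<inter> Y frontier_of ?S \<noteq> {}"
      by (intro boundary_bumping_theorem_closed D C closedin_closure_of)
    moreover have "?C \<subseteq> ?X"
    proof (rule subset_meager_composant_of)
      show "nowhere_dense_in Y ?C"
        using CC V(3) p(1) by (intro indecomposable_imp_nowhere_dense_in Y ind) auto
      show "x \<in> ?C"
        using xS by (simp add: connected_component_of_refl)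
    qed (rule CC)
    moreover have "V \<inter> Y frontier_of ?S = {}"
      using interior_of_maximal[OF \<open>V \<subseteq> ?S\<close> V(1)] by (auto simp: frontier_of_def)
    ultimately show False
      using V(2) XY closure_of_subset[of ?X Y] by blast
  qed
  then show ?thesis
    using XY by (simp add: dense_in_def)
qed

text \<open>The components containing the given point of the complements of the basic open sets
  form a countable nowhere dense cover of the composant, so Baire's theorem applies.\<close>
lemma indecomposable_meager_composant_of_proper:
  assumes Y: "continuum_space Y" and ind: "indecomposable Y" and x: "x \<in> topspace Y"
  shows "meager_composant_of Y x \<noteq> topspace Y"
proof -
  note D = continuum_spaceD[OF Y]
  have "second_countable Y"
    using Y D(2) compact_metrizable_imp_second_countable by (auto simp: continuum_space_def)
  then obtain B where B: "countable B" "\<And>V. V \<in> B \<Longrightarrow> openin Y V"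
      "\<And>U x. openin Y U \<Longrightarrow> x \<in> U \<Longrightarrow> \<exists>V\<in>B. x \<in> V \<and> V \<subseteq> U"
    unfolding second_countable_def by metis
  define C where "C V = connected_component_of_set (subtopology Y (topspace Y - V)) x" for V
  \<comment> \<open>\<open>V \<noteq> {}\<close> keeps \<open>C V\<close> proper, and
    \<open>x \<notin> V\<close> makes \<open>C V\<close> a genuine component.\<close>
  let ?G = "C ` {V \<in> B. V \<noteq> {} \<and> x \<notin> V}"
  have "Y interior_of \<Union>?G = {}"
  proof (rule Baire_category_alt)
    show "countable ?G"
      using B(1) by (simp add: countable_subset)
  next
    fix T assume "T \<in> ?G"
    then obtain V where V: "V \<in> B" "V \<noteq> {}" "x \<notin> V" "T = C V"
      by blast
    have "T \<in> connected_components_of (subtopology Y (topspace Y - V))"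
      using V x by (simp add: C_def connected_component_in_connected_components_of)
    then have T: "subcontinuum Y T" "T \<subseteq> topspace Y - V"
      using component_of_closedin_subcontinuum[OF D(2,3)] B(2)[OF V(1)] by blast+
    moreover have "V \<subseteq> topspace Y"
      using B(2)[OF V(1)] openin_subset by blast
    ultimately have "nowhere_dense_in Y T"
      using V(2) by (intro indecomposable_imp_nowhere_dense_in Y ind) auto
    moreover have "closedin Y T"
      using T(1) by (simp add: subcontinuum_iff_closedin[OF D(2,3)])
    ultimately show "closedin Y T \<and> Y interior_of T = {}"
      by (simp add: nowhere_dense_in_def closure_of_closedin)
  qed (use D in auto)
  moreover have "meager_composant_of Y x \<subseteq> \<Union>?G"
  proof
    fix z assume "z \<in> meager_composant_of Y x"
    then obtain K where K: "subcontinuum Y K" "x \<in> K" "z \<in> K" "nowhere_dense_in Y K"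
      by (auto simp: meager_composant_of_def)
    then have cK: "closedin Y K" "connectedin Y K"
      by (simp_all add: subcontinuum_iff_closedin[OF D(2,3)])
    \<comment> \<open>A nowhere dense \<open>K\<close> omits a point; as \<open>K\<close> is closed,
      some basic \<open>V\<close> around that point misses \<open>K\<close>, and so \<open>K\<close>
      lies in \<open>C V\<close>.\<close>
    have "K \<noteq> topspace Y"
      using K(4) D(6) by (auto simp: nowhere_dense_in_def)
    then obtain p where "p \<in> topspace Y - K"
      using cK(1) closedin_subset by fastforce
    then obtain V where V: "V \<in> B" "p \<in> V" "V \<subseteq> topspace Y - K"
      using B(3)[of "topspace Y - K" p] cK(1) by blast
    have "connectedin (subtopology Y (topspace Y - V)) K"
      using cK V(3) connectedin_subset_topspace[OF cK(2)] by (auto simp: connectedin_subtopology)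
    then have "K \<subseteq> C V"
      unfolding C_def using K(2) connected_component_of_maximal by metis
    then show "z \<in> \<Union>?G"
      using K V by blast
  qed
  ultimately show ?thesis
    using D(6) by (metis interior_of_mono interior_of_topspace subset_empty)
qed

text \<open>Both claims use an omitted point \<open>y\<close>: a continuum that meets
  \<open>X\<close> and contains \<open>y\<close> must be all of \<open>Y\<close>, and the components
  of a closed neighbourhood avoiding \<open>y\<close> are proper, hence nowhere dense.\<close>

lemma indecomposable_imp_meager_composant:
  assumes Y: "continuum_space Y" and ind: "indecomposable Y" and x: "x \<in> topspace Y"
  defines "X \<equiv> meager_composant_of Y x"
  shows "singular_dense_in Y X" "filament_set Y X"
proof -
  note D = continuum_spaceD[OF Y]
  note sc = subcontinuum_iff_closedin[OF D(2,3)]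
  have dense: "dense_in Y X"
    unfolding X_def by (rule indecomposable_meager_composant_of_dense[OF Y ind x])
  have conn: "connectedin Y X"
    unfolding X_def by (rule connectedin_meager_composant_of)
  have XY: "X \<subseteq> topspace Y"
    by (rule connectedin_subset_topspace[OF conn])
  have "X \<noteq> topspace Y"
    unfolding X_def by (rule indecomposable_meager_composant_of_proper[OF Y ind x])
  then obtain y where y: "y \<in> topspace Y" "y \<notin> X"
    using XY by blast
  \<comment> \<open>By indecomposability the union of \<open>L\<close> with a nowhere dense
    continuum containing \<open>x\<close> and \<open>q\<close> is still proper, so it is one of the
    continua making up \<open>X\<close>.\<close>
  have mem: "L \<subseteq> X" if L: "subcontinuum Y L" "L \<noteq> topspace Y" "q \<in> L" "q \<in> X" for L q
  proof -
    obtain K where K: "subcontinuum Y K" "x \<in> K" "nowhere_dense_in Y K" "q \<in> K"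
      using L(4) by (auto simp: X_def meager_composant_of_def)
    have cl: "closedin Y K" "closedin Y L" "connectedin Y K" "connectedin Y L"
      using K(1) L(1) by (auto simp: sc)
    have "K \<noteq> topspace Y"
      using K(3) D(6) by (auto simp: nowhere_dense_in_def)
    then have "K \<union> L \<noteq> topspace Y"
      using ind K(1) L(1,2) unfolding decomposable_def by metis
    moreover have "subcontinuum Y (K \<union> L)"
      using cl K(2,4) L(3) by (auto simp: sc intro!: connectedin_Un)
    ultimately have "K \<union> L \<subseteq> X"
      unfolding X_def using K(2)
      by (intro subset_meager_composant_of indecomposable_imp_nowhere_dense_in Y ind) auto
    then show ?thesis by blast
  qed
  have "singular_wrt Y X y"
    unfolding singular_wrt_def
  proof (intro conjI allI impI conn y)
    fix C assume C: "C \<subseteq> X" and "connectedin Y C \<and> y \<in> Y closure_of C"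
    then have cC: "connectedin Y C" and yC: "y \<in> Y closure_of C"
      by auto
    obtain q where q: "q \<in> C"
      using yC by fastforce
    have sub: "C \<subseteq> Y closure_of C"
      using C XY by (intro closure_of_subset) blast
    have "subcontinuum Y (Y closure_of C)"
      using cC yC by (auto simp: sc connectedin_closure_of)
    \<comment> \<open>A proper closure would meet \<open>X\<close> in \<open>q\<close> and so lie
      inside \<open>X\<close>, against \<open>y \<notin> X\<close>.\<close>
    then have "Y closure_of C = topspace Y"
      using mem[of "Y closure_of C" q] q sub C yC y(2) by blast
    then show "subtopology Y X closure_of C = X"
      using C XY by (simp add: closure_of_subtopology Int_absorb1 Int_absorb2)
  qed
  then show "singular_dense_in Y X"
    using dense y(1) by (auto simp: singular_dense_in_def singular_in_def)
  show "filament_set Y X"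
    unfolding filament_set_def
  proof (intro conjI allI impI XY)
    fix K assume K: "subcontinuum Y K \<and> K \<subseteq> X"
    then have cK: "closedin Y K" "connectedin Y K" "K \<noteq> {}"
      by (auto simp: sc)
    have "openin Y (topspace Y - {y})" "K \<subseteq> topspace Y - {y}"
      using y K XY D(3) by (auto simp: closedin_Hausdorff_sing_eq)
    then obtain V where V: "openin Y V" "K \<subseteq> V" "Y closure_of V \<subseteq> topspace Y - {y}"
      using D(4) cK(1) unfolding normal_space_alt by metis
    let ?N = "Y closure_of V"
    have VN: "V \<subseteq> ?N"
      by (simp add: V(1) closure_of_subset openin_subset)
    have "connectedin (subtopology Y ?N) K"
      using cK(2) V(2) VN by (auto simp: connectedin_subtopology)
    then obtain C where C: "C \<in> connected_components_of (subtopology Y ?N)" "K \<subseteq> C"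
      using exists_connected_component_of_superset[of "subtopology Y ?N" K] cK(3)
      by (metis connectedin_subset_topspace subset_empty topspace_discrete_topology)
    have "nowhere_dense_in Y C"
      using component_of_closedin_subcontinuum[OF D(2,3) closedin_closure_of C(1)] V(3) y(1)
      by (intro indecomposable_imp_nowhere_dense_in Y ind) auto
    moreover have "K \<subseteq> Y interior_of ?N"
      using V(1,2) VN by (meson interior_of_maximal subset_trans)
    ultimately show "filament_subcontinuum Y K"
      unfolding filament_subcontinuum_def using K C by (meson closure_of_subset_topspace)
  qed
qed

section \<open>Connected subsets of singular dense sets\<close>

lemma singular_dense_inE:
  assumes "singular_dense_in Y X"
  obtains y where "connectedin Y X" "Y closure_of X = topspace Y" "y \<in> topspace Y"
    "\<forall>C. C \<subseteq> X \<longrightarrow> connectedin Y C \<and> y \<in> Y closure_of C \<longrightarrow> subtopology Y X closure_of C = X"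
proof -
  obtain y where y: "singular_wrt Y X y" and "Y closure_of X = topspace Y"
    using assms unfolding singular_dense_in_def singular_in_def dense_in_def by blast
  then show ?thesis
    using y[unfolded singular_wrt_def] by (intro that[of y]) simp_all
qed

text \<open>By density the witness \<open>y\<close> is in the closure of \<open>A\<close> or of
  \<open>B\<close>; singularity makes that piece relatively dense, and it is relatively
  closed.\<close>

lemma singular_dense_in_closed_connected:
  assumes "singular_dense_in Y X"
    and A: "closedin (subtopology Y X) A" "connectedin Y A"
    and B: "closedin (subtopology Y X) B" "connectedin Y B"
    and AB: "A \<union> B = X"
  shows "A = X \<or> B = X"
proof -
  obtain y where dense: "Y closure_of X = topspace Y" and y: "y \<in> topspace Y" and sing:
      "\<forall>C. C \<subseteq> X \<longrightarrow> connectedin Y C \<and> y \<in> Y closure_of C \<longrightarrow> subtopology Y X closure_of C = X"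
    by (rule singular_dense_inE[OF assms(1)])
  have "y \<in> Y closure_of A \<union> Y closure_of B"
    using dense y AB by (simp flip: closure_of_Un)
  then have "subtopology Y X closure_of A = X \<or> subtopology Y X closure_of B = X"
    using sing[rule_format, of A] sing[rule_format, of B] A(2) B(2) AB by blast
  then show ?thesis
    using A(1) B(1) by (simp add: closure_of_closedin)
qed

text \<open>If the closure of \<open>A\<close> had interior, its trace on \<open>X\<close> would be
  a proper closed connected subset with relative interior, and the subspace \<open>X\<close> would
  split into two proper pieces.\<close>

lemma singular_dense_in_nowhere_dense_in:
  assumes sd: "singular_dense_in Y X" and A: "A \<subseteq> X" "connectedin Y A" "Y closure_of A \<noteq> topspace Y"
  shows "nowhere_dense_in Y A"
proof -
  let ?Z = "subtopology Y X"
  obtain conn: "connectedin Y X" and dense: "Y closure_of X = topspace Y"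
    by (rule singular_dense_inE[OF sd])
  have XY: "X \<subseteq> topspace Y"
    by (rule connectedin_subset_topspace[OF conn])
  then have topZ: "topspace ?Z = X"
    by auto
  let ?K = "X \<inter> Y closure_of A"
  have K: "closedin ?Z ?K"
    by (simp add: closedin_subtopology_Int_closed)
  have "A \<subseteq> Y closure_of A"
    using A(1) XY by (intro closure_of_subset) blast
  then have cK: "connectedin Y ?K"
    using A(1) by (intro connectedin_intermediate_closure_of[OF A(2)]) auto
  have "\<not> X \<subseteq> Y closure_of A"
    using A(3) dense closure_of_minimal[of X "Y closure_of A" Y] closure_of_subset_topspace[of Y A] by auto
  then have neK: "?K \<noteq> topspace ?Z"
    using topZ by blast
  have "Y interior_of (Y closure_of A) = {}"
  proof (rule ccontr)
    let ?W = "Y interior_of (Y closure_of A)"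
    assume ne: "?W \<noteq> {}"
    \<comment> \<open>Density of \<open>X\<close> turns interior in \<open>Y\<close> into relative
      interior in \<open>X\<close>.\<close>
    have "?W \<inter> X \<noteq> {}"
      using ne dense openin_Int_closure_of_eq_empty[of Y ?W X] interior_of_subset_topspace[of Y]
      by fastforce
    moreover have "openin ?Z (X \<inter> ?W)"
      by (simp add: openin_subtopology_Int2)
    moreover have "X \<inter> ?W \<subseteq> ?K"
      using interior_of_subset by fast
    ultimately have "?Z interior_of ?K \<noteq> {}"
      using interior_of_maximal[of "X \<inter> ?W" ?K ?Z] by blast
    moreover have "connected_space ?Z"
      using conn by (simp add: connectedin_def)
    moreover have "connectedin ?Z ?K"
      using cK by (simp add: connectedin_subtopology)
    ultimately obtain P Q where
        P: "closedin ?Z P" "connectedin ?Z P" "P \<noteq> topspace ?Z" and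
        Q: "closedin ?Z Q" "connectedin ?Z Q" "Q \<noteq> topspace ?Z" and PQ: "P \<union> Q = topspace ?Z"
      using proper_closed_connected_decomposition[OF _ K _ neK] by metis
    have "connectedin Y P" "connectedin Y Q"
      using P(2) Q(2) by (simp_all add: connectedin_subtopology)
    then show False
      using singular_dense_in_closed_connected[OF sd P(1) _ Q(1)] P(3) Q(3) PQ topZ by auto
  qed
  then show ?thesis
    using A(2) connectedin_subset_topspace by (auto simp: nowhere_dense_in_def)
qed

section \<open>The filament condition and the equivalence\<close>

lemma meager_composant_in_proper_subcontinuum:
  assumes Y: "continuum_space Y" and fil: "filament_set Y (meager_composant_of Y x)"
    and sd: "singular_dense_in Y (meager_composant_of Y x)"
    and H: "subcontinuum Y H" "H \<noteq> topspace Y" "x \<in> H"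
  shows "Y interior_of H = {}"
proof (rule ccontr)
  assume int: "Y interior_of H \<noteq> {}"
  note D = continuum_spaceD[OF Y]
  note sc = subcontinuum_iff_closedin[OF D(2,3)]
  have cH: "closedin Y H" "connectedin Y H" "compactin Y H"
    using H(1) sc[of H] by (auto simp: subcontinuum_def)
  let ?X = "meager_composant_of Y x"
  have XY: "?X \<subseteq> topspace Y"
    by (rule connectedin_subset_topspace[OF connectedin_meager_composant_of])
  \<comment> \<open>Staying inside \<open>H\<close> keeps the closure of the union proper, which is
    what makes the union nowhere dense.\<close>
  define \<A> where "\<A> = {K. subcontinuum Y K \<and> x \<in> K \<and> nowhere_dense_in Y K \<and> K \<subseteq> H}"
  define A where "A = \<Union>\<A>"
  have AX: "A \<subseteq> ?X" and AH: "A \<subseteq> H"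
    by (auto simp: A_def \<A>_def meager_composant_of_def)
  have conA: "connectedin Y A"
    unfolding A_def
  proof (rule connectedin_Union)
    show "\<Inter>\<A> \<noteq> {}" by (auto simp: \<A>_def)
  qed (auto simp: \<A>_def subcontinuum_def)
  have clA: "Y closure_of A \<subseteq> H"
    by (simp add: AH cH(1) closure_of_minimal)
  moreover have "H \<subseteq> topspace Y"
    using cH(1) closedin_subset by blast
  ultimately have "Y closure_of A \<noteq> topspace Y"
    using H(2) by blast
  then have nd: "nowhere_dense_in Y A"
    using singular_dense_in_nowhere_dense_in[OF sd AX conA] by blast
  \<comment> \<open>Density makes the composant nonempty, so some nowhere dense subcontinuum
    contains \<open>x\<close>; hence \<open>{x}\<close> is a member of the family.\<close>
  have "?X \<noteq> {}"
    using sd D(6) unfolding singular_dense_in_def dense_in_def by (metis closure_of_empty)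
  then have "x \<in> topspace Y" and nd_x: "nowhere_dense_in Y {x}"
    using XY nowhere_dense_in_subset[of Y _ "{x}"] H(3) \<open>H \<subseteq> topspace Y\<close>
    by (auto simp: meager_composant_of_def)
  then have "{x} \<in> \<A>"
    using H(3) by (auto simp: \<A>_def subcontinuum_def)
  then have xA: "x \<in> A"
    by (auto simp: A_def)
  let ?L = "Y closure_of A"
  have AL: "A \<subseteq> ?L"
    using AX XY by (intro closure_of_subset) blast
  have L: "subcontinuum Y ?L"
    using conA xA AL by (auto simp: sc connectedin_closure_of)
  \<comment> \<open>So \<open>A\<close> is closed and is the largest member of the family.\<close>
  have "?L \<in> \<A>"
    using L xA AL clA nowhere_dense_in_closure_of[OF nd] by (auto simp: \<A>_def)
  then have "?L \<subseteq> ?X" "?L \<subseteq> A"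
    using AX by (auto simp: A_def)
  then have "filament_subcontinuum Y ?L"
    using fil L by (auto simp: filament_set_def)
  then obtain N C where N: "N \<subseteq> topspace Y" "?L \<subseteq> Y interior_of N"
    and C: "C \<in> connected_components_of (subtopology Y N)" "?L \<subseteq> C" "nowhere_dense_in Y C"
    unfolding filament_subcontinuum_def by blast
  \<comment> \<open>The enlargement takes place inside \<open>H\<close>, so that the larger
    continuum \<open>E\<close> is still a candidate for the family. There is room for it:
    \<open>H\<close> has interior and \<open>?L\<close> does not.\<close>
  let ?Z = "subtopology Y H"
  have topZ: "topspace ?Z = H"
    using \<open>H \<subseteq> topspace Y\<close> by auto
  have "nowhere_dense_in Y ?L"
    using nowhere_dense_in_closure_of[OF nd] .
  then have "?L \<noteq> H"
    using int by (auto simp: nowhere_dense_in_def)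
  have Z: "connected_space ?Z" "locally_compact_space ?Z" "Hausdorff_space ?Z"
    using cH D(3) by (auto simp: connectedin_def compact_space_subtopology Hausdorff_space_subtopology
        intro!: compact_imp_locally_compact_space)
  have LZ: "compactin ?Z ?L" "connectedin ?Z ?L" "?L \<noteq> {}" "?L \<noteq> topspace ?Z"
    using L clA topZ \<open>?L \<noteq> H\<close> by (auto simp: subcontinuum_def compactin_subtopology connectedin_subtopology)
  have U: "openin ?Z (H \<inter> Y interior_of N)" "?L \<subseteq> H \<inter> Y interior_of N"
    using N(2) clA by (auto simp: openin_subtopology_Int2)
  obtain E where E: "compactin ?Z E" "connectedin ?Z E" "?L \<subset> E" "E \<subset> H \<inter> Y interior_of N"
    using intermediate_continuum_exists[OF Z LZ U] .
  have E': "compactin Y E" "connectedin Y E" "E \<subseteq> H" "E \<subseteq> N"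
    using E interior_of_subset[of Y N] by (auto simp: compactin_subtopology connectedin_subtopology)
  \<comment> \<open>\<open>E\<close> is a connected subset of \<open>N\<close> meeting
    \<open>C\<close>, so it lies in that component and inherits its nowhere density.\<close>
  have "connectedin (subtopology Y N) E"
    using E' by (auto simp: connectedin_subtopology)
  moreover have "\<not> disjnt C E"
    using C(2) E(3) xA AL by (auto simp: disjnt_iff)
  ultimately have "E \<subseteq> C"
    using C(1) connected_components_of_maximal by blast
  then have "E \<in> \<A>"
    using C(3) E' E(3) xA AL nowhere_dense_in_subset[of Y C E] by (auto simp: \<A>_def subcontinuum_def)
  then have "E \<subseteq> ?L"
    using AL by (auto simp: A_def)
  then show False
    using E(3) by blast
qed

theorem theorem1p4:
  fixes Y :: "'a topology"
  assumes "continuum_space Y"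
  shows "indecomposable Y \<longleftrightarrow>
    (\<exists>X. meager_composant Y X \<and> singular_dense_in Y X \<and> filament_set Y X)"
proof
  assume "indecomposable Y"
  then show "\<exists>X. meager_composant Y X \<and> singular_dense_in Y X \<and> filament_set Y X"
    using indecomposable_imp_meager_composant[OF assms] continuum_spaceD(6)[OF assms]
    by (meson all_not_in_conv meager_composant_def)
next
  note D = continuum_spaceD[OF assms]
  note sc = subcontinuum_iff_closedin[OF D(2,3)]
  assume "\<exists>X. meager_composant Y X \<and> singular_dense_in Y X \<and> filament_set Y X"
  then obtain x where x: "x \<in> topspace Y" "singular_dense_in Y (meager_composant_of Y x)"
      "filament_set Y (meager_composant_of Y x)"
    by (auto simp: meager_composant_def)
  \<comment> \<open>The two pieces play symmetric roles, so \<open>x\<close> may be taken to lie in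
    \<open>H\<close>; the complement of \<open>K\<close> then gives \<open>H\<close>
    interior.\<close>
  have False if H: "subcontinuum Y H" "H \<noteq> topspace Y" "x \<in> H"
    and K: "subcontinuum Y K" "K \<noteq> topspace Y" "topspace Y = H \<union> K" for H K
  proof -
    have "openin Y (topspace Y - K)" "topspace Y - K \<subseteq> H" "topspace Y - K \<noteq> {}"
      using K closedin_subset[of Y K] sc[of K] openin_diff[OF openin_topspace, of Y K] by blast+
    then have "Y interior_of H \<noteq> {}"
      by (metis interior_of_maximal subset_empty)
    then show False
      using meager_composant_in_proper_subcontinuum[OF assms x(3,2) H] by blast
  qed
  then show "indecomposable Y"
    unfolding decomposable_def using x(1) by (metis Un_commute Un_iff)
qed

end
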